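(* Let $(G,K,H,E)$ be a trifactorised group. Every $g\in G$ can be written uniquely as $g=k_ge_g$ with $k_g\in K$ and $e_g\in E$. Then: (1) $H$ acts on $K$ by automorphisms via $\tilde\lambda(h)(k)=e_hke_h^{-1}$ for $h\in H$, $k\in K$. (2) The map $\sigma\colon H\to K$, $\sigma(h)=k_h$, is a bijective derivation with respect to $\tilde\lambda$, i.e. $\sigma$ is bijective and $\sigma(h_1h_2)=\sigma(h_1)\,\tilde\lambda(h_1)(\sigma(h_2))$ for all $h_1,h_2\in H$. (3) For $k\in K$ let $\epsilon_k\in E$ be the unique element of $E$ with $k\epsilon_k\in H$. If one defines the operation $\boxdot$ on $K$ by $k_1\boxdot k_2=k_1\,(\epsilon_{k_1}k_2\epsilon_{k_1}^{-1})$ for $k_1,k_2\in K$, then $(K,\cdot,\boxdot)$ is a skew left brace (with additive operation the group operation $\cdot$ of $K$ inherited from $G$, and multiplicative operation $\boxdot$), $(K,\boxdot)\cong H$, and its lambda map is $\tilde\lambda\circ\sigma^{-1}\colon(K,\boxdot)\to\operatorname{Aut}(K)$.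
   Context: A trifactorised group is a tuple $(G,K,H,E)$ with $G$ a group, $K\trianglelefteq G$, $H,E\le G$, $G=KE=KH=HE$ and $K\cap E=H\cap E=1$ (nothing is required of $K\cap H$). A skew left brace $(B,+,\cdot)$ is a set with two group operations ($+$ not necessarily commutative) such that $a(b+c)=ab-a+ac$ for all $a,b,c\in B$. Its lambda map is the homomorphism $\lambda\colon (B,\cdot)\to\operatorname{Aut}(B,+)$, $\lambda_a(b)=-a+ab$. *)

theory Defs
  imports "HOL-Algebra.Bij" "HOL-Algebra.Coset"
begin

locale trifactorised_group = group G
  for G (structure) and K H E +
  assumes K_normal: "K \<lhd> G"
    and H_subgroup: "subgroup H G"
    and E_subgroup: "subgroup E G"
    and carrier_eq_KE: "carrier G = K <#> E"
    and carrier_eq_KH: "carrier G = K <#> H"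
    and carrier_eq_HE: "carrier G = H <#> E"
    and K_Int_E: "K \<inter> E = {\<one>}"
    and H_Int_E: "H \<inter> E = {\<one>}"

text \<open>The additive group \<open>A\<close> (not necessarily commutative, written multiplicatively as every
  group in HOL-Algebra) and the multiplicative group \<open>M\<close> are two group structures on the same
  carrier; the last assumption reads $a(b+c) = ab - a + ac$.\<close>

locale skew_left_brace = add: group A + mult: group M
  for A :: "('a, 'm) monoid_scheme" and M :: "('a, 'n) monoid_scheme" +
  assumes carrier_eq: "carrier M = carrier A"
    and left_distrib: "\<lbrakk>a \<in> carrier A; b \<in> carrier A; c \<in> carrier A\<rbrakk> \<Longrightarrow>
      a \<otimes>\<^bsub>M\<^esub> (b \<otimes>\<^bsub>A\<^esub> c) = (a \<otimes>\<^bsub>M\<^esub> b) \<otimes>\<^bsub>A\<^esub> inv\<^bsub>A\<^esub> a \<otimes>\<^bsub>A\<^esub> (a \<otimes>\<^bsub>M\<^esub> c)"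

text \<open>$\lambda_a(b) = -a + ab$. Elements of \<^const>\<open>AutoGroup\<close> are extensional, so each
  $\lambda_a$ (and likewise each \<open>tri_lambda\<close> value below) is restricted to the carrier.\<close>

definition brace_lambda ::
    "('a, 'm) monoid_scheme \<Rightarrow> ('a, 'n) monoid_scheme \<Rightarrow> 'a \<Rightarrow> 'a \<Rightarrow> 'a" where
  "brace_lambda A M =
    (\<lambda>a\<in>carrier A. \<lambda>b\<in>carrier A. inv\<^bsub>A\<^esub> a \<otimes>\<^bsub>A\<^esub> (a \<otimes>\<^bsub>M\<^esub> b))"

definition derivation ::
    "('a, 'm) monoid_scheme \<Rightarrow> ('b, 'n) monoid_scheme \<Rightarrow> ('a \<Rightarrow> 'b \<Rightarrow> 'b) \<Rightarrow> ('a \<Rightarrow> 'b) \<Rightarrow> bool" where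
  "derivation P Q act d \<longleftrightarrow>
     d \<in> carrier P \<rightarrow> carrier Q \<and>
     (\<forall>x\<in>carrier P. \<forall>y\<in>carrier P. d (x \<otimes>\<^bsub>P\<^esub> y) = d x \<otimes>\<^bsub>Q\<^esub> act x (d y))"

text \<open>For \<open>g\<close> in \<open>G = KE\<close> with \<open>K \<inter> E = 1\<close>: the components of $g = k_g e_g$.\<close>

definition K_part :: "('a, 'm) monoid_scheme \<Rightarrow> 'a set \<Rightarrow> 'a set \<Rightarrow> 'a \<Rightarrow> 'a" where
  "K_part G K E g = fst (THE p. p \<in> K \<times> E \<and> g = fst p \<otimes>\<^bsub>G\<^esub> snd p)"

definition E_part :: "('a, 'm) monoid_scheme \<Rightarrow> 'a set \<Rightarrow> 'a set \<Rightarrow> 'a \<Rightarrow> 'a" where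
  "E_part G K E g = snd (THE p. p \<in> K \<times> E \<and> g = fst p \<otimes>\<^bsub>G\<^esub> snd p)"

definition tri_lambda :: "('a, 'm) monoid_scheme \<Rightarrow> 'a set \<Rightarrow> 'a set \<Rightarrow> 'a \<Rightarrow> 'a \<Rightarrow> 'a" where
  "tri_lambda G K E h =
    (\<lambda>k\<in>K. E_part G K E h \<otimes>\<^bsub>G\<^esub> k \<otimes>\<^bsub>G\<^esub> inv\<^bsub>G\<^esub> (E_part G K E h))"

definition tri_sigma :: "('a, 'm) monoid_scheme \<Rightarrow> 'a set \<Rightarrow> 'a set \<Rightarrow> 'a set \<Rightarrow> 'a \<Rightarrow> 'a" where
  "tri_sigma G K H E = (\<lambda>h\<in>H. K_part G K E h)"

definition tri_eps :: "('a, 'm) monoid_scheme \<Rightarrow> 'a set \<Rightarrow> 'a set \<Rightarrow> 'a \<Rightarrow> 'a" where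
  "tri_eps G H E k = (THE e. e \<in> E \<and> k \<otimes>\<^bsub>G\<^esub> e \<in> H)"

definition tri_box :: "('a, 'm) monoid_scheme \<Rightarrow> 'a set \<Rightarrow> 'a set \<Rightarrow> 'a \<Rightarrow> 'a \<Rightarrow> 'a" where
  "tri_box G H E k1 k2 =
    k1 \<otimes>\<^bsub>G\<^esub> (tri_eps G H E k1 \<otimes>\<^bsub>G\<^esub> k2 \<otimes>\<^bsub>G\<^esub> inv\<^bsub>G\<^esub> (tri_eps G H E k1))"

text \<open>The structure $(K,\boxdot)$. A record must name its neutral element; both operations of a
  skew left brace share theirs, so it is that of \<open>G\<close>.\<close>

definition box_group ::
    "('a, 'm) monoid_scheme \<Rightarrow> 'a set \<Rightarrow> 'a set \<Rightarrow> 'a set \<Rightarrow> 'a monoid" where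
  "box_group G K H E = \<lparr>carrier = K, mult = tri_box G H E, one = \<one>\<^bsub>G\<^esub>\<rparr>"

end

theory Submission
  imports Defs
begin

text \<open>
  Since \<open>K\<close> is normal, \<open>G = KE\<close> with \<open>K \<inter> E = 1\<close> makes \<open>g \<mapsto> e\<^sub>g\<close> a homomorphism from \<open>G\<close> to
  \<open>E\<close> (the projection with kernel \<open>K\<close>), and \<open>G\<close> acts on \<open>K\<close> by conjugation. The action in (1) is
  the composition of the two, restricted to \<open>H\<close>. Collecting factors in
  \<open>k\<^sub>1e\<^sub>1k\<^sub>2e\<^sub>2 = k\<^sub>1(e\<^sub>1k\<^sub>2e\<^sub>1\<inverse>)\<cdot>e\<^sub>1e\<^sub>2\<close> shows both that \<open>g \<mapsto> e\<^sub>g\<close> is multiplicative and that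
  \<open>\<sigma>\<close> is a derivation (\<open>E_part_mult\<close>, \<open>K_part_mult\<close>).

  The other factorisation \<open>G = HE\<close>, \<open>H \<inter> E = 1\<close> says that \<open>H\<close>, like \<open>K\<close>, is a transversal of the
  cosets \<open>gE\<close>. As \<open>\<sigma>(h)\<close> is the element of \<open>K\<close> in \<open>hE\<close>, it is the canonical bijection
  between the two transversals; its inverse is \<open>k \<mapsto> k\<epsilon>\<^sub>k\<close>.

  From \<open>\<sigma>(h)e\<^sub>h = h\<close> one reads off \<open>\<epsilon>\<^bsub>\<sigma>(h)\<^esub> = e\<^sub>h\<close>, so the derivation law becomes
  \<open>\<sigma>(h\<^sub>1h\<^sub>2) = \<sigma>(h\<^sub>1) \<boxdot> \<sigma>(h\<^sub>2)\<close>. Hence \<open>\<boxdot>\<close> is the multiplication of \<open>H\<close> transported to \<open>K\<close>, and (3)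
  is an instance of the fact that a bijective derivation from a group \<open>P\<close> onto a group \<open>A\<close> turns \<open>A\<close>
  into a skew left brace whose lambda map is the action of \<open>P\<close>
  (\<open>bijective_derivation_skew_left_brace\<close>).
\<close>

section \<open>Complements and conjugation\<close>

lemma (in group) inv_cancel_left:
  assumes "x \<in> carrier G" "y \<in> carrier G"
  shows "inv x \<otimes> (x \<otimes> y) = y" "x \<otimes> (inv x \<otimes> y) = y"
  using assms by (simp_all add: m_assoc [symmetric])

lemma (in group) trivial_Int_factors_unique:
  assumes "subgroup X G" "subgroup Y G" "X \<inter> Y = {\<one>}"
    and x: "x \<in> X" "x' \<in> X" and y: "y \<in> Y" "y' \<in> Y"
    and eq: "x \<otimes> y = x' \<otimes> y'"
  shows "x = x'" "y = y'"
proof -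
  interpret X: subgroup X G by fact
  interpret Y: subgroup Y G by fact
  have c: "x \<in> carrier G" "x' \<in> carrier G" "y \<in> carrier G" "y' \<in> carrier G"
    using x y by auto
  have "inv x' \<otimes> x = inv x' \<otimes> (x \<otimes> y) \<otimes> inv y"
    using c by (simp add: m_assoc)
  also have "\<dots> = y' \<otimes> inv y"
    using c by (simp add: eq m_assoc [symmetric])
  finally have *: "inv x' \<otimes> x = y' \<otimes> inv y" .
  have "inv x' \<otimes> x \<in> X" "y' \<otimes> inv y \<in> Y"
    using x y by auto
  with * assms(3) have "inv x' \<otimes> x = \<one>" by auto
  then show "x = x'"
    using c by (metis inv_equality inv_inv inv_closed)
  with eq c show "y = y'" by simp
qed

lemma (in group) conjugation_hom_AutoGroup:
  assumes "N \<lhd> G"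
  shows "(\<lambda>g. \<lambda>n\<in>N. g \<otimes> n \<otimes> inv g) \<in> hom G (AutoGroup (G\<lparr>carrier := N\<rparr>))"
    (is "?c \<in> _")
proof -
  interpret N: normal N G by fact
  have in_auto: "?c g \<in> auto (G\<lparr>carrier := N\<rparr>)" if g: "g \<in> carrier G" for g
  proof -
    have "bij_betw (?c g) N N"
      by (rule bij_betw_byWitness [where f' = "\<lambda>n. inv g \<otimes> n \<otimes> g"])
        (use g N.inv_op_closed1 N.inv_op_closed2 in \<open>auto simp: m_assoc inv_cancel_left\<close>)
    moreover have "g \<otimes> (m \<otimes> n) \<otimes> inv g = (g \<otimes> m \<otimes> inv g) \<otimes> (g \<otimes> n \<otimes> inv g)"
      if "m \<in> N" "n \<in> N" for m n
      using that g by (simp add: m_assoc inv_cancel_left)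
    ultimately show ?thesis
      using g N.inv_op_closed2 by (auto simp: auto_def hom_def Bij_def)
  qed
  have "?c (g \<otimes> h) = compose N (?c g) (?c h)" if "g \<in> carrier G" "h \<in> carrier G" for g h
    using that N.inv_op_closed2
    by (auto simp: compose_def inv_mult_group m_assoc intro!: restrict_ext)
  then show ?thesis
    using in_auto by (auto simp: hom_def AutoGroup_def BijGroup_def auto_def)
qed

section \<open>Bijective derivations and skew left braces\<close>

lemma derivation_one:
  assumes P: "group P" and A: "group A" and act: "act \<in> hom P (AutoGroup A)"
    and d: "derivation P A act d"
  shows "d \<one>\<^bsub>P\<^esub> = \<one>\<^bsub>A\<^esub>"
proof -
  interpret P: group P by fact
  interpret A: group A by fact
  have d1: "d \<one>\<^bsub>P\<^esub> \<in> carrier A"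
    using d by (auto simp: derivation_def)
  have "act \<one>\<^bsub>P\<^esub> = \<one>\<^bsub>AutoGroup A\<^esub>"
    using act P A.AutoGroup by (rule hom_one)
  then have "act \<one>\<^bsub>P\<^esub> (d \<one>\<^bsub>P\<^esub>) = d \<one>\<^bsub>P\<^esub>"
    using d1 by (simp add: AutoGroup_def BijGroup_def)
  then have "d \<one>\<^bsub>P\<^esub> = d \<one>\<^bsub>P\<^esub> \<otimes>\<^bsub>A\<^esub> d \<one>\<^bsub>P\<^esub>"
    using d by (metis derivation_def P.one_closed P.l_one)
  then show ?thesis
    using d1 by (metis A.l_cancel_one')
qed

text \<open>
  Under \<open>d\<close> the derivation law reads \<open>ab = a + \<lambda>\<^sub>a(b)\<close> with \<open>\<lambda>\<^sub>a\<close> the automorphism by which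
  \<open>d\<inverse>(a)\<close> acts. This identifies the lambda map, and additivity of \<open>\<lambda>\<^sub>a\<close> is the brace law:
  \<open>a + \<lambda>\<^sub>a(b + c) = (a + \<lambda>\<^sub>a(b)) - a + (a + \<lambda>\<^sub>a(c))\<close>.
\<close>

lemma bijective_derivation_skew_left_brace:
  fixes A :: "('a, 'm) monoid_scheme" and M :: "('a, 'n) monoid_scheme"
    and P :: "('b, 'p) monoid_scheme"
  assumes P: "group P" and A: "group A" and act: "act \<in> hom P (AutoGroup A)"
    and d: "derivation P A act d" and bij: "bij_betw d (carrier P) (carrier A)"
    and d_hom: "d \<in> hom P M" and carr: "carrier M = carrier A" and one: "\<one>\<^bsub>M\<^esub> = \<one>\<^bsub>A\<^esub>"
  shows "skew_left_brace A M"
    and "brace_lambda A M = compose (carrier A) act (inv_into (carrier P) d)"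
proof -
  interpret P: group P by fact
  interpret A: group A by fact
  let ?l = "\<lambda>a. act (inv_into (carrier P) d a)"
  have l_auto: "?l a \<in> auto A" if "a \<in> carrier A" for a
    using that act bij by (auto simp: hom_def AutoGroup_def bij_betw_def inv_into_into)
  have l_closed: "?l a b \<in> carrier A" if "a \<in> carrier A" "b \<in> carrier A" for a b
    using l_auto [OF that(1)] that(2) by (auto simp: auto_def hom_def)
  have l_add: "?l a (b \<otimes>\<^bsub>A\<^esub> c) = ?l a b \<otimes>\<^bsub>A\<^esub> ?l a c"
    if "a \<in> carrier A" "b \<in> carrier A" "c \<in> carrier A" for a b c
    using l_auto [OF that(1)] that(2,3) by (auto simp: auto_def hom_def)
  have mult_eq: "a \<otimes>\<^bsub>M\<^esub> b = a \<otimes>\<^bsub>A\<^esub> ?l a b" if a: "a \<in> carrier A" and b: "b \<in> carrier A" for a b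
  proof -
    obtain x y where xy: "x \<in> carrier P" "y \<in> carrier P" "a = d x" "b = d y"
      using a b bij by (metis bij_betw_imp_surj_on imageE)
    moreover have "inv_into (carrier P) d (d x) = x"
      using bij xy(1) by (simp add: bij_betw_def)
    ultimately show ?thesis
      using d d_hom by (metis derivation_def hom_mult)
  qed

  have "d \<in> iso P M"
    using d_hom bij carr by (simp add: iso_def)
  then have "group (M\<lparr>one := d \<one>\<^bsub>P\<^esub>\<rparr>)"
    by (rule P.iso_imp_img_group)
  moreover have "d \<one>\<^bsub>P\<^esub> = \<one>\<^bsub>M\<^esub>"
    using derivation_one [OF P A act d] one by simp
  ultimately have "group M" by simp
  moreover have "a \<otimes>\<^bsub>M\<^esub> (b \<otimes>\<^bsub>A\<^esub> c) = (a \<otimes>\<^bsub>M\<^esub> b) \<otimes>\<^bsub>A\<^esub> inv\<^bsub>A\<^esub> a \<otimes>\<^bsub>A\<^esub> (a \<otimes>\<^bsub>M\<^esub> c)"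
    if "a \<in> carrier A" "b \<in> carrier A" "c \<in> carrier A" for a b c
    using that l_closed by (simp add: mult_eq l_add A.m_assoc A.inv_cancel_left)
  ultimately show "skew_left_brace A M"
    using A carr by (simp add: skew_left_brace_def skew_left_brace_axioms_def)

  have "(\<lambda>b\<in>carrier A. inv\<^bsub>A\<^esub> a \<otimes>\<^bsub>A\<^esub> (a \<otimes>\<^bsub>M\<^esub> b)) = ?l a" if a: "a \<in> carrier A" for a
  proof (rule extensionalityI)
    show "?l a \<in> extensional (carrier A)"
      using l_auto [OF a] by (simp add: auto_def Bij_def)
  qed (use a l_closed in \<open>simp_all add: mult_eq A.m_assoc [symmetric]\<close>)
  then show "brace_lambda A M = compose (carrier A) act (inv_into (carrier P) d)"
    unfolding brace_lambda_def compose_def by (rule restrict_ext)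
qed

section \<open>Trifactorised groups\<close>

context trifactorised_group
begin

sublocale K: normal K G by (rule K_normal)
sublocale H: subgroup H G by (rule H_subgroup)
sublocale E: subgroup E G by (rule E_subgroup)

lemma ex1_KE_decomposition:
  assumes "g \<in> carrier G"
  shows "\<exists>!p. p \<in> K \<times> E \<and> g = fst p \<otimes> snd p"
proof -
  obtain k e where "k \<in> K" "e \<in> E" "g = k \<otimes> e"
    using assms carrier_eq_KE by (auto simp: set_mult_def)
  then show ?thesis
    using trivial_Int_factors_unique [OF K.subgroup_axioms E_subgroup K_Int_E]
    by (intro ex1I [of _ "(k, e)"]) auto
qed

lemma KE_parts:
  assumes "g \<in> carrier G"
  shows K_part_closed: "K_part G K E g \<in> K"
    and E_part_closed: "E_part G K E g \<in> E"
    and K_part_E_part: "K_part G K E g \<otimes> E_part G K E g = g"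
  using theI' [OF ex1_KE_decomposition [OF assms]]
  by (auto simp: K_part_def E_part_def mem_Times_iff)

lemma KE_parts_unique:
  assumes "k \<in> K" "e \<in> E"
  shows K_part_eq: "K_part G K E (k \<otimes> e) = k" and E_part_eq: "E_part G K E (k \<otimes> e) = e"
proof -
  have "k \<otimes> e \<in> carrier G" using assms by simp
  note parts = KE_parts [OF this]
  show "K_part G K E (k \<otimes> e) = k" "E_part G K E (k \<otimes> e) = e"
    using trivial_Int_factors_unique [OF K.subgroup_axioms E_subgroup K_Int_E
        parts(1) assms(1) parts(2) assms(2) parts(3)] .
qed

lemma KE_parts_mult:
  assumes g: "g \<in> carrier G" and h: "h \<in> carrier G"
  shows K_part_mult: "K_part G K E (g \<otimes> h) =
      K_part G K E g \<otimes> (E_part G K E g \<otimes> K_part G K E h \<otimes> inv (E_part G K E g))"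
    and E_part_mult: "E_part G K E (g \<otimes> h) = E_part G K E g \<otimes> E_part G K E h"
proof -
  define k e k' e' where defs: "k = K_part G K E g" "e = E_part G K E g"
    "k' = K_part G K E h" "e' = E_part G K E h"
  have mem: "k \<in> K" "e \<in> E" "k' \<in> K" "e' \<in> E" and eq: "g = k \<otimes> e" "h = k' \<otimes> e'"
    unfolding defs using KE_parts g h by simp_all
  have "g \<otimes> h = (k \<otimes> (e \<otimes> k' \<otimes> inv e)) \<otimes> (e \<otimes> e')"
    unfolding eq using mem by (simp add: m_assoc inv_cancel_left)
  moreover have "k \<otimes> (e \<otimes> k' \<otimes> inv e) \<in> K" "e \<otimes> e' \<in> E"
    using mem K.inv_op_closed2 by auto
  ultimately have "K_part G K E (g \<otimes> h) = k \<otimes> (e \<otimes> k' \<otimes> inv e)"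
    "E_part G K E (g \<otimes> h) = e \<otimes> e'"
    by (simp_all only: KE_parts_unique)
  then show "K_part G K E (g \<otimes> h) =
      K_part G K E g \<otimes> (E_part G K E g \<otimes> K_part G K E h \<otimes> inv (E_part G K E g))"
    "E_part G K E (g \<otimes> h) = E_part G K E g \<otimes> E_part G K E h"
    by (simp_all only: defs)
qed

lemma tri_lambda_hom:
  "tri_lambda G K E \<in> hom (G\<lparr>carrier := H\<rparr>) (AutoGroup (G\<lparr>carrier := K\<rparr>))"
proof -
  have "E_part G K E \<in> hom (G\<lparr>carrier := H\<rparr>) G"
    by (auto simp: hom_def E_part_mult E_part_closed)
  then have "(\<lambda>g. \<lambda>k\<in>K. g \<otimes> k \<otimes> inv g) \<circ> E_part G K E
      \<in> hom (G\<lparr>carrier := H\<rparr>) (AutoGroup (G\<lparr>carrier := K\<rparr>))"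
    using conjugation_hom_AutoGroup [OF K_normal] by (rule Group.hom_compose)
  then show ?thesis
    by (simp add: tri_lambda_def [abs_def] comp_def)
qed

lemma tri_sigma_derivation:
  "derivation (G\<lparr>carrier := H\<rparr>) (G\<lparr>carrier := K\<rparr>) (tri_lambda G K E) (tri_sigma G K H E)"
  by (auto simp: derivation_def tri_sigma_def tri_lambda_def K_part_mult K_part_closed)

text \<open>
  For injectivity and surjectivity alike, \<open>\<sigma>(h) = he\<inverse>\<close> with \<open>e \<in> E\<close> is read as the factorisation
  of an element of \<open>K\<close> in \<open>G = HE\<close>.
\<close>

lemma tri_sigma_bij: "bij_betw (tri_sigma G K H E) H K"
proof (rule bij_betwI')
  fix h h' assume h: "h \<in> H" "h' \<in> H"
  have "h = h'" if eq: "K_part G K E h = K_part G K E h'"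
  proof -
    have K_part_H: "K_part G K E x = x \<otimes> inv (E_part G K E x)" if "x \<in> H" for x
      using that KE_parts [of x] by (simp add: inv_solve_right)
    show ?thesis
      by (rule trivial_Int_factors_unique(1) [OF H_subgroup E_subgroup H_Int_E h])
        (use h eq K_part_H in \<open>auto simp: E_part_closed\<close>)
  qed
  then show "tri_sigma G K H E h = tri_sigma G K H E h' \<longleftrightarrow> h = h'"
    using h by (auto simp: tri_sigma_def)
next
  fix h assume "h \<in> H"
  then show "tri_sigma G K H E h \<in> K"
    by (simp add: tri_sigma_def K_part_closed)
next
  fix k assume k: "k \<in> K"
  then have "k \<in> H <#> E"
    using carrier_eq_HE K.mem_carrier by blast
  then obtain h e where he: "h \<in> H" "e \<in> E" "k = h \<otimes> e"
    by (auto simp: set_mult_def)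
  then have "h = k \<otimes> inv e" by (simp add: m_assoc)
  then have "tri_sigma G K H E h = k"
    using he k K_part_eq [of k "inv e"] by (simp add: tri_sigma_def)
  with he(1) show "\<exists>h\<in>H. k = tri_sigma G K H E h" by auto
qed

lemma unique_H_completion:
  assumes "k \<in> K" "e \<in> E" "e' \<in> E" "k \<otimes> e \<in> H" "k \<otimes> e' \<in> H"
  shows "e = e'"
proof -
  have "(k \<otimes> e) \<otimes> inv e = (k \<otimes> e') \<otimes> inv e'"
    using assms(1-3) by (simp add: m_assoc)
  then have "inv e = inv e'"
    using trivial_Int_factors_unique(2) [OF H_subgroup E_subgroup H_Int_E assms(4,5)] assms(2,3)
    by simp
  with assms(2,3) show ?thesis by (metis E.mem_carrier inv_inv)
qed

lemma ex1_eps: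
  assumes k: "k \<in> K"
  shows "\<exists>!e. e \<in> E \<and> k \<otimes> e \<in> H"
proof -
  obtain h where "h \<in> H" "k = K_part G K E h"
    using tri_sigma_bij k by (auto simp: bij_betw_def tri_sigma_def)
  then have "E_part G K E h \<in> E \<and> k \<otimes> E_part G K E h \<in> H"
    by (simp add: KE_parts)
  then show ?thesis
    using unique_H_completion [OF k] by blast
qed

lemma tri_eps_sigma:
  assumes h: "h \<in> H"
  shows "tri_eps G H E (tri_sigma G K H E h) = E_part G K E h"
  unfolding tri_eps_def
proof (rule the1_equality)
  show "\<exists>!e. e \<in> E \<and> tri_sigma G K H E h \<otimes> e \<in> H"
    using h by (intro ex1_eps) (simp add: tri_sigma_def K_part_closed)
  show "E_part G K E h \<in> E \<and> tri_sigma G K H E h \<otimes> E_part G K E h \<in> H"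
    using h by (simp add: tri_sigma_def KE_parts)
qed

lemma tri_sigma_iso: "tri_sigma G K H E \<in> iso (G\<lparr>carrier := H\<rparr>) (box_group G K H E)"
proof -
  have "tri_sigma G K H E (x \<otimes> y) = tri_box G H E (tri_sigma G K H E x) (tri_sigma G K H E y)"
    if "x \<in> H" "y \<in> H" for x y
    unfolding tri_box_def tri_eps_sigma [OF that(1)]
    using that by (simp add: tri_sigma_def K_part_mult)
  then show ?thesis
    using tri_sigma_bij by (auto simp: iso_def hom_def box_group_def bij_betw_def)
qed

end

theorem proposition3p2:
  fixes G :: "('a, 'm) monoid_scheme" and K H E :: "'a set"
  assumes "trifactorised_group G K H E"
  shows "(\<forall>g\<in>carrier G. \<exists>!p. p \<in> K \<times> E \<and> g = fst p \<otimes>\<^bsub>G\<^esub> snd p) \<and>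
    tri_lambda G K E \<in> hom (G\<lparr>carrier := H\<rparr>) (AutoGroup (G\<lparr>carrier := K\<rparr>)) \<and>
    bij_betw (tri_sigma G K H E) H K \<and>
    derivation (G\<lparr>carrier := H\<rparr>) (G\<lparr>carrier := K\<rparr>) (tri_lambda G K E) (tri_sigma G K H E) \<and>
    (\<forall>k\<in>K. \<exists>!e. e \<in> E \<and> k \<otimes>\<^bsub>G\<^esub> e \<in> H) \<and>
    skew_left_brace (G\<lparr>carrier := K\<rparr>) (box_group G K H E) \<and>
    box_group G K H E \<cong> G\<lparr>carrier := H\<rparr> \<and>
    brace_lambda (G\<lparr>carrier := K\<rparr>) (box_group G K H E)
      = compose K (tri_lambda G K E) (inv_into H (tri_sigma G K H E)) \<and>
    brace_lambda (G\<lparr>carrier := K\<rparr>) (box_group G K H E)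
      \<in> hom (box_group G K H E) (AutoGroup (G\<lparr>carrier := K\<rparr>))"
proof -
  interpret trifactorised_group G K H E by fact
  have HG: "group (G\<lparr>carrier := H\<rparr>)" and KG: "group (G\<lparr>carrier := K\<rparr>)"
    using H_subgroup K.subgroup_axioms by (simp_all add: subgroup_imp_group)
  have inv_iso: "inv_into H (tri_sigma G K H E) \<in> iso (box_group G K H E) (G\<lparr>carrier := H\<rparr>)"
    using group.iso_set_sym [OF HG tri_sigma_iso] by simp
  note brace = bijective_derivation_skew_left_brace [OF HG KG tri_lambda_hom tri_sigma_derivation,
      of "box_group G K H E"]
  have slb: "skew_left_brace (G\<lparr>carrier := K\<rparr>) (box_group G K H E)"
    by (rule brace(1)) (use tri_sigma_bij tri_sigma_iso in \<open>auto simp: iso_def box_group_def\<close>)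
  have lambda: "brace_lambda (G\<lparr>carrier := K\<rparr>) (box_group G K H E)
      = compose K (tri_lambda G K E) (inv_into H (tri_sigma G K H E))"
    using brace(2) tri_sigma_bij tri_sigma_iso by (simp add: iso_def box_group_def)
  have "group (box_group G K H E)"
    using slb by (simp add: skew_left_brace_def)
  then have "compose K (tri_lambda G K E) (inv_into H (tri_sigma G K H E))
      \<in> hom (box_group G K H E) (AutoGroup (G\<lparr>carrier := K\<rparr>))"
    using group.hom_compose [OF _ iso_imp_homomorphism [OF inv_iso] tri_lambda_hom]
    by (simp add: box_group_def)
  with slb lambda inv_iso show ?thesis
    using ex1_KE_decomposition tri_lambda_hom tri_sigma_bij tri_sigma_derivation ex1_eps
    by (auto simp: is_iso_def)
qed

end
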